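(* Let $m,n$ be positive integers and let $S_j \subset \mathbb{R}$, $j=1,2,\ldots,m$, be convex subsets of the real line. Let $f: S_1\times S_2\times\cdots\times S_m\rightarrow\mathbb{R}$ be a function of class $\mathcal{C}^m$. If $f$ is monotonically increasing (resp. decreasing) with respect to its inputs in $S_1\times\cdots\times S_m$, then $\mathrm{Tr}\circ f$ is monotonically increasing (resp. decreasing) with respect to its inputs in $\mathcal{M}_{\mathrm{herm}^n}(S_1)\times\cdots\times \mathcal{M}_{\mathrm{herm}^n}(S_m)$. That is, for all $(M_1,\ldots,M_m), (N_1,\ldots,N_m) \in \mathcal{M}_{\mathrm{herm}^n}(S_1)\times\cdots\times \mathcal{M}_{\mathrm{herm}^n}(S_m)$ such that $M_l \succcurlyeq N_l$ for all $l=1,2,\ldots,m$, we have $$\mathrm{Tr}\left(f(M_1,\ldots,M_m)\right) \geq \mathrm{Tr}\left(f(N_1,\ldots,N_m)\right)$$ when $f$ is monotonically increasing (resp. $\leq$ when $f$ is monotonically decreasing).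
   Context: For $S\subseteq\mathbb{R}$, $\mathcal{M}_{\mathrm{herm}^n}(S)$ is the set of $n\times n$ (complex) Hermitian matrices all of whose eigenvalues lie in $S$. For matrices $A,B$, $A\succcurlyeq B$ means that $A-B$ is positive semi-definite, i.e. $\mathbf{x}^*(A-B)\mathbf{x}\ge 0$ for all $\mathbf{x}\in\mathbb{C}^n$. Extension of $f$ to matrices: for diagonalizable $n\times n$ matrices $M_j = P_j\,\mathrm{diag}(\lambda_{j1},\ldots,\lambda_{jn})P_j^{-1}$ with all eigenvalues $\lambda_{jk}\in S_j$, $j=1,\ldots,m$, the matrix $f(M_1,\ldots,M_m)\in\mathbb{C}^{n^m\times n^m}$ is $$f(M_1,\ldots,M_m)=\Big(\bigotimes_{j=1}^m P_j\Big)\,\mathrm{diag}_{j_1,\ldots,j_m}\big(f(\lambda_{1j_1},\ldots,\lambda_{mj_m})\big)\,\Big(\bigotimes_{j=1}^m P_j^{-1}\Big),$$ where $\otimes$ is the Kronecker product and the diagonal matrix has its $n^m$ entries indexed by $(j_1,\ldots,j_m)\in\{1,\ldots,n\}^m$ in lexicographic order. Hence $(\mathrm{Tr}\circ f)(M_1,\ldots,M_m)=\mathrm{Tr}(f(M_1,\ldots,M_m))=\sum_{j_1,\ldots,j_m=1}^n f(\lambda_{1j_1},\ldots,\lambda_{mj_m})$. "Monotonically increasing (decreasing) with respect to its inputs" means weakly increasing (decreasing) in each scalar variable separately. *)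

theory Defs
  imports
    "HOL-Analysis.Function_Topology"
    "HOL-Analysis.Convex"
    "Jordan_Normal_Form.Schur_Decomposition"
begin

text \<open>
  Points of the real space of dimension \<open>m\<close> are represented as extensional functions on
  \<open>{..<m}\<close>, so that \<open>S\<^sub>1 \<times> \<dots> \<times> S\<^sub>m\<close> is \<open>PiE {..<m} S\<close>, carrying the (Euclidean)
  subspace topology of the product topology on \<open>nat \<Rightarrow> real\<close>. All indices start at \<open>0\<close>.
\<close>

text \<open>
  Class \<open>C\<^sup>k\<close> on a box of intervals that need not be open: all iterated partial derivatives up to
  order \<open>k\<close> exist (one-sided at boundary points) and are continuous on the box. If \<open>S j\<close> is a
  single point, every number is a derivative within \<open>S j\<close>, so such a coordinate imposes no
  differentiability condition; the derivative \<open>g\<close> may then be taken to be \<open>0\<close>.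
\<close>

fun class_C :: "nat \<Rightarrow> nat \<Rightarrow> (nat \<Rightarrow> real set) \<Rightarrow> ((nat \<Rightarrow> real) \<Rightarrow> real) \<Rightarrow> bool" where
  "class_C 0 m S f \<longleftrightarrow> continuous_on (PiE {..<m} S) f"
| "class_C (Suc k) m S f \<longleftrightarrow> continuous_on (PiE {..<m} S) f \<and>
     (\<forall>j<m. \<exists>g. (\<forall>x\<in>PiE {..<m} S.
          ((\<lambda>t. f (x(j := t))) has_real_derivative g x) (at (x j) within S j)) \<and>
        class_C k m S g)"

definition incr_in_each :: "nat \<Rightarrow> (nat \<Rightarrow> real set) \<Rightarrow> ((nat \<Rightarrow> real) \<Rightarrow> real) \<Rightarrow> bool" where
  "incr_in_each m S f \<longleftrightarrow>
     (\<forall>x\<in>PiE {..<m} S. \<forall>j<m. \<forall>t\<in>S j. x j \<le> t \<longrightarrow> f x \<le> f (x(j := t)))"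

definition decr_in_each :: "nat \<Rightarrow> (nat \<Rightarrow> real set) \<Rightarrow> ((nat \<Rightarrow> real) \<Rightarrow> real) \<Rightarrow> bool" where
  "decr_in_each m S f \<longleftrightarrow>
     (\<forall>x\<in>PiE {..<m} S. \<forall>j<m. \<forall>t\<in>S j. x j \<le> t \<longrightarrow> f (x(j := t)) \<le> f x)"

definition herm_mats :: "nat \<Rightarrow> real set \<Rightarrow> complex mat set" where
  "herm_mats n S = {A \<in> carrier_mat n n. mat_adjoint A = A \<and>
     (\<forall>z. eigenvalue A z \<longrightarrow> z \<in> complex_of_real ` S)}"

text \<open>
  On \<open>complex\<close>, \<open>a \<le> b\<close> means \<open>Re a \<le> Re b\<close> and \<open>Im a = Im b\<close>; hence \<open>0 \<le> z\<close> says that \<open>z\<close> is real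
  and nonnegative. Since \<open>v \<bullet>c w\<close> conjugates its second argument, the scalar below is
  \<open>x\<^sup>* (A - B) x\<close>.
\<close>

definition loewner_ge :: "nat \<Rightarrow> complex mat \<Rightarrow> complex mat \<Rightarrow> bool" where
  "loewner_ge n A B \<longleftrightarrow> (\<forall>x\<in>carrier_vec n. 0 \<le> ((A - B) *\<^sub>v x) \<bullet>c x)"

definition kronecker :: "complex mat \<Rightarrow> complex mat \<Rightarrow> complex mat" where
  "kronecker A B = Matrix.mat (dim_row A * dim_row B) (dim_col A * dim_col B)
     (\<lambda>(i, j). A $$ (i div dim_row B, j div dim_col B) * B $$ (i mod dim_row B, j mod dim_col B))"

primrec kronecker_prod :: "nat \<Rightarrow> (nat \<Rightarrow> complex mat) \<Rightarrow> complex mat" where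
  "kronecker_prod 0 P = 1\<^sub>m 1"
| "kronecker_prod (Suc m) P = kronecker (kronecker_prod m P) (P m)"

text \<open>
  \<open>lex_index m n a j\<close> is the \<open>j\<close>-th component of the \<open>a\<close>-th tuple of \<open>{..<n}\<^sup>m\<close> in lexicographic
  order, i.e. the \<open>j\<close>-th base-\<open>n\<close> digit of \<open>a\<close>, most significant first.
\<close>

definition lex_index :: "nat \<Rightarrow> nat \<Rightarrow> nat \<Rightarrow> nat \<Rightarrow> nat" where
  "lex_index m n a j = a div n ^ (m - 1 - j) mod n"

definition is_matrix_fun ::
  "nat \<Rightarrow> nat \<Rightarrow> (nat \<Rightarrow> real set) \<Rightarrow> ((nat \<Rightarrow> real) \<Rightarrow> real) \<Rightarrow> (nat \<Rightarrow> complex mat) \<Rightarrow> complex mat \<Rightarrow> bool"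
  where
  "is_matrix_fun m n S f M F \<longleftrightarrow> (\<exists>P Q ev.
     (\<forall>j<m. M j \<in> carrier_mat n n \<and>
        similar_mat_wit (M j) (mat_diag n (\<lambda>k. complex_of_real (ev j k))) (P j) (Q j) \<and>
        (\<forall>k<n. ev j k \<in> S j)) \<and>
     F = kronecker_prod m P
       * mat_diag (n ^ m) (\<lambda>a. complex_of_real (f (\<lambda>j\<in>{..<m}. ev j (lex_index m n a j))))
       * kronecker_prod m Q)"

text \<open>
  The matrix \<open>F\<close> does not depend on the diagonalizations chosen in \<open>is_matrix_fun\<close>.
\<close>

definition matrix_fun ::
  "nat \<Rightarrow> nat \<Rightarrow> (nat \<Rightarrow> real set) \<Rightarrow> ((nat \<Rightarrow> real) \<Rightarrow> real) \<Rightarrow> (nat \<Rightarrow> complex mat) \<Rightarrow> complex mat"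
  where "matrix_fun m n S f M = (SOME F. is_matrix_fun m n S f M F)"

definition mat_trace :: "complex mat \<Rightarrow> complex" where
  "mat_trace A = (\<Sum>i<dim_row A. A $$ (i, i))"

end

theory Submission
  imports Defs
begin

text \<open>
  The trace of \<open>f(M\<^sub>1, \<dots>, M\<^sub>m)\<close> is the sum of \<open>f\<close> over all \<open>m\<close>-tuples of eigenvalues, one taken
  from each \<open>M\<^sub>j\<close> (\<open>mat_trace_is_matrix_fun\<close>): the Kronecker products of the \<open>P\<^sub>j\<close> and of
  their inverses are inverse to each other and cancel under the trace. This sum does not see the
  order in which the eigenvalues of each \<open>M\<^sub>j\<close> are listed.

  The Loewner order controls the eigenvalues themselves. By Weyl's theorem
  (\<open>weyl_monotonicity\<close>), if \<open>A \<succeq> B\<close> are Hermitian and their eigenvalues are listed in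
  increasing order, counting from \<open>1\<close>, then the \<open>k\<close>-th eigenvalue of \<open>A\<close> is at least the \<open>k\<close>-th eigenvalue
  of \<open>B\<close>. The reason is a dimension count: the span of the eigenvectors of \<open>A\<close> belonging to its
  \<open>k\<close> smallest eigenvalues and the span of the eigenvectors of \<open>B\<close> belonging to all but its
  \<open>k - 1\<close> smallest ones have dimensions \<open>k\<close> and \<open>n - k + 1\<close>, so they share a vector \<open>x \<noteq> 0\<close>
  (\<open>separating_vector\<close>), and comparing \<open>x\<^sup>* A x\<close> with \<open>x\<^sup>* B x\<close> gives the inequality.

  Hence, if \<open>M\<^sub>l \<succeq> N\<^sub>l\<close> for all \<open>l\<close>, each list of eigenvalues of \<open>N\<^sub>l\<close> is dominated entry by
  entry by a permutation of the list for \<open>M\<^sub>l\<close>. The two sums are then compared term by term,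
  after a permutation of the index tuples (\<open>trace_sum_mono\<close>). The decreasing case is the
  increasing case for \<open>- f\<close>.
\<close>

section \<open>Hermitian matrices\<close>

lemma mat_adjoint_carrier [simp, intro]:
  fixes A :: "complex mat"
  shows "A \<in> carrier_mat n m \<Longrightarrow> mat_adjoint A \<in> carrier_mat m n"
  unfolding mat_adjoint_def by auto

lemma dim_mat_adjoint [simp]:
  fixes A :: "complex mat"
  shows "dim_row (mat_adjoint A) = dim_col A" "dim_col (mat_adjoint A) = dim_row A"
  unfolding mat_adjoint_def by auto

lemma index_mat_adjoint [simp]:
  fixes A :: "complex mat"
  shows "i < dim_col A \<Longrightarrow> j < dim_row A \<Longrightarrow> mat_adjoint A $$ (i, j) = cnj (A $$ (j, i))"
  unfolding mat_adjoint_def by (auto simp: mat_of_rows_index)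

lemma mat_adjoint_mult:
  fixes A :: "complex mat"
  assumes "A \<in> carrier_mat n m" "B \<in> carrier_mat m k"
  shows "mat_adjoint (A * B) = mat_adjoint B * mat_adjoint A"
  by (rule eq_matI) (use assms in \<open>auto simp: scalar_prod_def mult.commute\<close>)

lemma mat_adjoint_adjoint [simp]:
  fixes A :: "complex mat"
  shows "mat_adjoint (mat_adjoint A) = A"
  by (rule eq_matI) auto

lemma adjoint_scalar_prod:
  fixes A :: "complex mat"
  assumes A: "A \<in> carrier_mat n m" and x: "x \<in> carrier_vec m" and y: "y \<in> carrier_vec n"
  shows "(A *\<^sub>v x) \<bullet>c y = x \<bullet>c (mat_adjoint A *\<^sub>v y)"
proof -
  have "(A *\<^sub>v x) \<bullet>c y = (\<Sum>i<n. \<Sum>j<m. A $$ (i, j) * x $ j * cnj (y $ i))"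
    using assms by (simp add: scalar_prod_def sum_distrib_right atLeast0LessThan)
  also have "\<dots> = (\<Sum>j<m. \<Sum>i<n. A $$ (i, j) * x $ j * cnj (y $ i))"
    by (rule sum.swap)
  also have "\<dots> = x \<bullet>c (mat_adjoint A *\<^sub>v y)"
    using assms by (simp add: scalar_prod_def sum_distrib_left mult_ac atLeast0LessThan)
  finally show ?thesis .
qed

definition unitary_mat :: "nat \<Rightarrow> complex mat \<Rightarrow> bool" where
  "unitary_mat n U \<longleftrightarrow>
     U \<in> carrier_mat n n \<and> mat_adjoint U * U = 1\<^sub>m n \<and> U * mat_adjoint U = 1\<^sub>m n"

lemma unitary_matI:
  assumes "U \<in> carrier_mat n n" "mat_adjoint U * U = 1\<^sub>m n"
  shows "unitary_mat n U"
  using assms mat_mult_left_right_inverse[of "mat_adjoint U" n U] by (auto simp: unitary_mat_def)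

lemma unitary_mat_mult:
  assumes U: "unitary_mat n U" and V: "unitary_mat n V"
  shows "unitary_mat n (U * V)"
proof (rule unitary_matI)
  have c: "U \<in> carrier_mat n n" "V \<in> carrier_mat n n"
    using U V by (auto simp: unitary_mat_def)
  then show "U * V \<in> carrier_mat n n" by simp
  have "mat_adjoint (U * V) * (U * V) = mat_adjoint V * ((mat_adjoint U * U) * V)"
    using c by (simp add: mat_adjoint_mult[OF c] assoc_mult_mat[of _ n n _ n _ n])
  then show "mat_adjoint (U * V) * (U * V) = 1\<^sub>m n"
    using U V c by (simp add: unitary_mat_def)
qed

lemma scalar_prod_self_conjugate:
  "(x :: complex vec) \<bullet>c x = of_real (\<Sum>i<dim_vec x. (cmod (x $ i))\<^sup>2)"
  by (simp add: scalar_prod_def atLeast0LessThan complex_norm_square del: of_real_power)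

text \<open>
  Gram-Schmidt applied to a basis that starts with \<open>v\<close> keeps \<open>v\<close> and produces orthogonal vectors
  of arbitrary length; normalizing them gives the columns of \<open>W\<close>.
\<close>

lemma unitary_first_column:
  fixes v :: "complex vec"
  assumes v: "v \<in> carrier_vec n" and v0: "v \<noteq> 0\<^sub>v n"
  obtains W c where "unitary_mat n W" "col W 0 = c \<cdot>\<^sub>v v"
proof -
  interpret cof_vec_space n "TYPE(complex)" .
  define b where "b = basis_completion v"
  from basis_completion[OF v v0, folded b_def]
  have b: "set b \<subseteq> carrier_vec n" "distinct b" "\<not> lin_dep (set b)" and hdb: "hd b = v"
    and lenb: "length b = n" by auto
  have n: "n \<noteq> 0" using v v0 by (metis carrier_vecD eq_vecI index_zero_vec(2) not_less_zero)
  obtain vs where bv: "b = v # vs" using hdb lenb n by (cases b) auto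
  define ws where "ws = gram_schmidt n b"
  from gram_schmidt_result[OF b ws_def]
  have ws: "set ws \<subseteq> carrier_vec n" "corthogonal ws" "length ws = n"
    by (auto simp: lenb)
  have hdws: "hd ws = v" using gram_schmidt_hd[OF v, of vs] by (simp add: ws_def bv)
  have wsc: "ws ! i \<in> carrier_vec n" if "i < n" for i
    using ws that by auto
  define r where "r i = sqrt (\<Sum>k<n. (cmod (ws ! i $ k))\<^sup>2)" for i
  have nrm: "ws ! i \<bullet>c ws ! i = of_real ((r i)\<^sup>2)" if "i < n" for i
    using wsc[OF that] by (simp add: scalar_prod_self_conjugate r_def sum_nonneg del: of_real_sum)
  have r0: "r i \<noteq> 0" if "i < n" for i
    using corthogonalD[OF ws(2), of i i] ws(3) nrm[OF that] that by auto
  define us where "us = map (\<lambda>i. of_real (1 / r i) \<cdot>\<^sub>v ws ! i) [0..<n]"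
  define W where "W = mat_of_cols n us"
  have W: "W \<in> carrier_mat n n" using mat_of_cols_carrier(1)[of n us] by (simp add: W_def us_def)
  have colW: "col W i = of_real (1 / r i) \<cdot>\<^sub>v ws ! i" if "i < n" for i
    unfolding W_def using that wsc[OF that] by (subst col_mat_of_cols) (auto simp: us_def)
  have "mat_adjoint W * W = 1\<^sub>m n"
  proof (rule eq_matI)
    fix i j assume "i < dim_row (1\<^sub>m n :: complex mat)" "j < dim_col (1\<^sub>m n :: complex mat)"
    then have ij: "i < n" "j < n" by auto
    have "(mat_adjoint W * W) $$ (i, j) = col W j \<bullet>c col W i"
      using ij W by (simp add: scalar_prod_def mult.commute)
    also have "\<dots> = of_real (1 / (r i * r j)) * (ws ! j \<bullet>c ws ! i)"
      using ij wsc[of i] wsc[of j] by (simp add: colW scalar_prod_def sum_distrib_left sum_divide_distrib mult_ac)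
    also have "\<dots> = 1\<^sub>m n $$ (i, j)"
      using ij corthogonalD[OF ws(2), of j i] ws(3) nrm[of i] r0[of i]
      by (auto simp: power2_eq_square)
    finally show "(mat_adjoint W * W) $$ (i, j) = 1\<^sub>m n $$ (i, j)" .
  qed (use W in auto)
  then have "unitary_mat n W" by (rule unitary_matI[OF W])
  moreover have "col W 0 = of_real (1 / r 0) \<cdot>\<^sub>v v"
    using colW[of 0] n hdws ws(3) by (metis hd_conv_nth gr0I list.size(3))
  ultimately show ?thesis by (rule that)
qed

text \<open>
  The spectral theorem, by deflation: in an orthonormal basis that starts with an eigenvector for
  \<open>e\<close>, the first column of the matrix vanishes off the diagonal; since the matrix is still
  Hermitian, so does its first row, and a Hermitian block of size \<open>n - 1\<close> remains. Prescribing the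
  list of eigenvalues makes it possible to choose the order in which they occur, which is what the
  comparison of ordered eigenvalues below needs.
\<close>

theorem hermitian_diagonalization:
  assumes "A \<in> carrier_mat n n" "mat_adjoint A = A"
    and "char_poly A = (\<Prod>e\<leftarrow>es. [:- e, 1:])"
  shows "\<exists>U. unitary_mat n U \<and> A = U * mat_diag n (\<lambda>i. es ! i) * mat_adjoint U"
  using assms
proof (induction es arbitrary: n A)
  case Nil
  then have "n = 0" using degree_monic_char_poly[of A n] by auto
  with Nil show ?case
    by (intro exI[of _ "1\<^sub>m 0"]) (auto intro!: eq_matI simp: unitary_mat_def)
next
  case (Cons e es n A)
  note A = Cons.prems(1) and herm = Cons.prems(2)
  have cp: "char_poly A = [:- e, 1:] * (\<Prod>e\<leftarrow>es. [:- e, 1:])" using Cons.prems(3) by simp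
  have "monic (\<Prod>e\<leftarrow>es. [:- e, 1:])" by (rule monic_prod_list) auto
  then have "degree (char_poly A) = Suc (degree (\<Prod>e\<leftarrow>es. [:- e, 1:]))"
    unfolding cp by (subst degree_mult_eq) auto
  then have "n \<noteq> 0" using degree_monic_char_poly[OF A] by auto
  then obtain k where n: "n = Suc k" by (cases n) auto
  have "eigenvalue A e" unfolding eigenvalue_root_char_poly[OF A] cp by simp
  then obtain v where v: "v \<in> carrier_vec n" "v \<noteq> 0\<^sub>v n" "A *\<^sub>v v = e \<cdot>\<^sub>v v"
    using A by (auto simp: eigenvalue_def eigenvector_def)
  obtain W c where uW: "unitary_mat n W" and W0: "col W 0 = c \<cdot>\<^sub>v v"
    using unitary_first_column[OF v(1,2)] .
  note [simp] = assoc_mult_mat[of _ n n _ n _ n] mult_carrier_mat[of _ n n _ n]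
  have W: "W \<in> carrier_mat n n" and W': "mat_adjoint W \<in> carrier_mat n n"
    and WW: "mat_adjoint W * W = 1\<^sub>m n" "W * mat_adjoint W = 1\<^sub>m n"
    using uW by (auto simp: unitary_mat_def)
  define A' where "A' = mat_adjoint W * A * W"
  have A': "A' \<in> carrier_mat n n"
    unfolding A'_def using W' A W by (intro mult_carrier_mat)
  have A_eq: "A = W * A' * mat_adjoint W"
  proof -
    have "W * A' * mat_adjoint W = (W * mat_adjoint W) * A * (W * mat_adjoint W)"
      using A W W' by (simp add: A'_def)
    then show ?thesis using A WW by simp
  qed
  have herm': "mat_adjoint A' = A'"
    using A W W' herm by (simp add: A'_def mat_adjoint_mult[of _ n n _ n])
  have col0: "col A' 0 = e \<cdot>\<^sub>v unit_vec n 0"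
  proof -
    have "col A' 0 = (mat_adjoint W * A) *\<^sub>v col W 0"
      unfolding A'_def using A W n by (subst col_mult2[of _ n n _ n]) auto
    also have "\<dots> = mat_adjoint W *\<^sub>v (A *\<^sub>v col W 0)"
      using A W by (intro assoc_mult_mat_vec[of _ n n _ n]) auto
    also have "A *\<^sub>v col W 0 = e \<cdot>\<^sub>v col W 0"
      using A v by (simp add: W0 mult_mat_vec[of _ n n] smult_smult_assoc mult.commute)
    also have "mat_adjoint W *\<^sub>v (e \<cdot>\<^sub>v col W 0) = e \<cdot>\<^sub>v (mat_adjoint W *\<^sub>v col W 0)"
      using W W' by (intro mult_mat_vec[of _ n n]) auto
    also have "mat_adjoint W *\<^sub>v col W 0 = col (mat_adjoint W * W) 0"
      using W W' n by (subst col_mult2[of _ n n _ n]) auto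
    also have "\<dots> = unit_vec n 0" using WW n by simp
    finally show ?thesis .
  qed
  define A3 where "A3 = Matrix.mat k k (\<lambda>(i, j). A' $$ (Suc i, Suc j))"
  have A3: "A3 \<in> carrier_mat k k" by (simp add: A3_def)
  have c0: "A' $$ (i, 0) = (if i = 0 then e else 0)" if "i < n" for i
    using arg_cong[OF col0, of "\<lambda>v. v $ i"] that A' n by auto
  have r0: "A' $$ (0, i) = cnj (A' $$ (i, 0))" if "i < n" for i
    using arg_cong[OF herm', of "\<lambda>B. B $$ (0, i)"] that A' n by auto
  define E where "E = Matrix.mat 1 1 (\<lambda>_. e)"
  have E: "E \<in> carrier_mat 1 1" by (simp add: E_def)
  have block: "A' = four_block_mat E (0\<^sub>m 1 k) (0\<^sub>m k 1) A3"
  proof (rule eq_matI)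
    fix i j assume "i < dim_row (four_block_mat E (0\<^sub>m 1 k) (0\<^sub>m k 1) A3)"
      "j < dim_col (four_block_mat E (0\<^sub>m 1 k) (0\<^sub>m k 1) A3)"
    then have ij: "i < n" "j < n" using n by (auto simp: E_def A3_def)
    then show "A' $$ (i, j) = four_block_mat E (0\<^sub>m 1 k) (0\<^sub>m k 1) A3 $$ (i, j)"
      using c0[of i] c0[of j] r0[of j] n by (cases i; cases j) (auto simp: E_def A3_def)
  qed (use A' n in \<open>auto simp: E_def A3_def\<close>)
  have herm3: "mat_adjoint A3 = A3"
  proof (rule eq_matI)
    fix i j assume "i < dim_row A3" "j < dim_col A3"
    then show "mat_adjoint A3 $$ (i, j) = A3 $$ (i, j)"
      using arg_cong[OF herm', of "\<lambda>B. B $$ (Suc i, Suc j)"] A' n by (auto simp: A3_def)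
  qed (auto simp: A3_def)
  have "similar_mat A A'"
    using similar_mat_witI[OF WW(2,1) A_eq A A' W W'] unfolding similar_mat_def by blast
  then have "char_poly A = char_poly E * char_poly A3"
    using char_poly_four_block_zeros_col[OF E _ A3] by (simp add: char_poly_similar block)
  also have "char_poly E = [:- e, 1:]"
    by (simp add: E_def char_poly_defs det_def sign_def)
  finally have "char_poly A3 = (\<Prod>e\<leftarrow>es. [:- e, 1:])"
    unfolding cp by (metis mult_cancel_left pCons_eq_0_iff zero_neq_one)
  from Cons.IH[OF A3 herm3 this] obtain U where uU: "unitary_mat k U"
    and A3_eq: "A3 = U * mat_diag k (\<lambda>i. es ! i) * mat_adjoint U" by blast
  have U: "U \<in> carrier_mat k k" and UU: "mat_adjoint U * U = 1\<^sub>m k"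
    using uU by (auto simp: unitary_mat_def)
  define X where "X = four_block_mat (1\<^sub>m 1) (0\<^sub>m 1 k) (0\<^sub>m k 1) U"
  have X: "X \<in> carrier_mat n n"
    using four_block_carrier_mat[of "1\<^sub>m 1" 1 1 U k k] U by (simp add: X_def n)
  have X': "mat_adjoint X = four_block_mat (1\<^sub>m 1) (0\<^sub>m 1 k) (0\<^sub>m k 1) (mat_adjoint U)"
    by (rule eq_matI) (use U in \<open>auto simp: X_def\<close>)
  have diag: "mat_diag n (\<lambda>i. (e # es) ! i) =
      four_block_mat E (0\<^sub>m 1 k) (0\<^sub>m k 1) (mat_diag k (\<lambda>i. es ! i))"
    by (rule eq_matI) (auto simp: mat_diag_def E_def n nth_Cons split: nat.split)
  have block_mult: "four_block_mat B (0\<^sub>m 1 k) (0\<^sub>m k 1) C * four_block_mat B' (0\<^sub>m 1 k) (0\<^sub>m k 1) C'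
      = four_block_mat (B * B') (0\<^sub>m 1 k) (0\<^sub>m k 1) (C * C')"
    if "B \<in> carrier_mat 1 1" "C \<in> carrier_mat k k" "B' \<in> carrier_mat 1 1" "C' \<in> carrier_mat k k"
    for B C B' C' :: "complex mat"
    using that by (subst mult_four_block_mat[of _ 1 1 _ k _ k _ _ 1 _ k]) auto
  have one: "four_block_mat (1\<^sub>m 1) (0\<^sub>m 1 k) (0\<^sub>m k 1) (1\<^sub>m k) = (1\<^sub>m n :: complex mat)"
    by (rule eq_matI) (auto simp: n)
  have "mat_adjoint X * X = four_block_mat (1\<^sub>m 1 * 1\<^sub>m 1) (0\<^sub>m 1 k) (0\<^sub>m k 1) (mat_adjoint U * U)"
    unfolding X' unfolding X_def by (rule block_mult) (use U in auto)
  also have "\<dots> = 1\<^sub>m n" using one UU by simp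
  finally have uX: "unitary_mat n X" by (rule unitary_matI[OF X])
  have A'_eq: "A' = X * mat_diag n (\<lambda>i. (e # es) ! i) * mat_adjoint X"
  proof -
    let ?D = "mat_diag k (\<lambda>i. es ! i)"
    have U': "mat_adjoint U \<in> carrier_mat k k" using U by simp
    have "X * mat_diag n (\<lambda>i. (e # es) ! i) = four_block_mat (1\<^sub>m 1 * E) (0\<^sub>m 1 k) (0\<^sub>m k 1) (U * ?D)"
      unfolding diag unfolding X_def by (rule block_mult) (use U E in auto)
    also have "\<dots> * mat_adjoint X
        = four_block_mat (1\<^sub>m 1 * E * 1\<^sub>m 1) (0\<^sub>m 1 k) (0\<^sub>m k 1) (U * ?D * mat_adjoint U)"
      unfolding X'
      by (rule block_mult) (use U U' E in \<open>auto intro: mult_carrier_mat[of _ k k _ k]\<close>)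
    also have "1\<^sub>m 1 * E * 1\<^sub>m 1 = E" using E by (simp add: right_mult_one_mat[of _ 1 1])
    finally show ?thesis unfolding block A3_eq ..
  qed
  have "A = (W * X) * mat_diag n (\<lambda>i. (e # es) ! i) * mat_adjoint (W * X)"
    unfolding A_eq A'_eq mat_adjoint_mult[OF W X] using W X by simp
  then show ?case using unitary_mat_mult[OF uW uX] by blast
qed

section \<open>Weyl monotonicity of eigenvalues\<close>

lemma mat_diag_mult_vec:
  fixes z :: "complex vec"
  assumes z: "z \<in> carrier_vec n"
  shows "mat_diag n a *\<^sub>v z = vec n (\<lambda>i. a i * z $ i)"
proof (rule eq_vecI)
  fix i assume "i < dim_vec (vec n (\<lambda>i. a i * z $ i))"
  then have i: "i < n" by simp
  have "(mat_diag n a *\<^sub>v z) $ i = (\<Sum>j<n. (if i = j then a j else 0) * z $ j)"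
    using i z by (simp add: mat_diag_def scalar_prod_def atLeast0LessThan)
  also have "\<dots> = (\<Sum>j<n. if i = j then a j * z $ j else 0)"
    by (rule sum.cong) auto
  finally show "(mat_diag n a *\<^sub>v z) $ i = vec n (\<lambda>i. a i * z $ i) $ i"
    using i by simp
qed (simp add: mat_diag_def)

lemma quadratic_form_diagonalized:
  assumes U: "unitary_mat n U" and x: "x \<in> carrier_vec n"
    and A: "A = U * mat_diag n (\<lambda>i. complex_of_real (d i)) * mat_adjoint U"
  shows "(A *\<^sub>v x) \<bullet>c x = of_real (\<Sum>i<n. d i * (cmod ((mat_adjoint U *\<^sub>v x) $ i))\<^sup>2)"
proof -
  let ?D = "mat_diag n (\<lambda>i. complex_of_real (d i))" and ?z = "mat_adjoint U *\<^sub>v x"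
  have c: "U \<in> carrier_mat n n" "mat_adjoint U \<in> carrier_mat n n" "?D \<in> carrier_mat n n"
    using U by (auto simp: unitary_mat_def)
  have z: "?z \<in> carrier_vec n" using c(2) x by (rule mult_mat_vec_carrier)
  have "A *\<^sub>v x = U *\<^sub>v (?D *\<^sub>v ?z)"
    using c x z unfolding A by (simp add: assoc_mult_mat_vec[of _ n n _ n] mult_carrier_mat[of _ n n _ n])
  then have "(A *\<^sub>v x) \<bullet>c x = (?D *\<^sub>v ?z) \<bullet>c ?z"
    using adjoint_scalar_prod[OF c(1) _ x, of "?D *\<^sub>v ?z"] mult_mat_vec_carrier[OF c(3) z] by simp
  also have "?D *\<^sub>v ?z = vec n (\<lambda>i. of_real (d i) * ?z $ i)"
    by (rule mat_diag_mult_vec[OF z])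
  also have "\<dots> \<bullet>c ?z = (\<Sum>i<n. of_real (d i) * (?z $ i * cnj (?z $ i)))"
  proof -
    have "vec n (\<lambda>i. of_real (d i) * w $ i) \<bullet>c w = (\<Sum>i<n. of_real (d i) * (w $ i * cnj (w $ i)))"
      if "w \<in> carrier_vec n" for w
      using that by (simp add: scalar_prod_def atLeast0LessThan mult.assoc)
    from this[OF z] show ?thesis .
  qed
  also have "\<dots> = of_real (\<Sum>i<n. d i * (cmod (?z $ i))\<^sup>2)"
    by (simp add: complex_norm_square del: of_real_power index_mult_mat_vec)
  finally show ?thesis .
qed

lemma unitary_norm:
  assumes U: "unitary_mat n U" and x: "x \<in> carrier_vec n"
  shows "(\<Sum>i<n. (cmod ((mat_adjoint U *\<^sub>v x) $ i))\<^sup>2) = (\<Sum>i<n. (cmod (x $ i))\<^sup>2)"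
proof -
  have "1\<^sub>m n = U * mat_diag n (\<lambda>i. complex_of_real 1) * mat_adjoint U"
    using U by (simp add: unitary_mat_def right_mult_one_mat[of U n n])
  from quadratic_form_diagonalized[OF U x this]
  have "x \<bullet>c x = of_real (\<Sum>i<n. (cmod ((mat_adjoint U *\<^sub>v x) $ i))\<^sup>2)"
    using x by simp
  with scalar_prod_self_conjugate[of x] x show ?thesis
    by (metis carrier_vecD of_real_eq_iff)
qed

text \<open>
  The conditions on \<open>x\<close> are \<open>n - 1\<close> homogeneous linear equations in \<open>n\<close> unknowns. As a square
  system they leave row \<open>k\<close> free; filling it with zeros makes the determinant vanish.
\<close>

lemma separating_vector:
  assumes U: "unitary_mat n U" and V: "unitary_mat n V" and k: "k < n"
  obtains x where "x \<in> carrier_vec n" "x \<noteq> 0\<^sub>v n"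
    "\<And>i. i < k \<Longrightarrow> (mat_adjoint V *\<^sub>v x) $ i = 0"
    "\<And>i. k < i \<Longrightarrow> i < n \<Longrightarrow> (mat_adjoint U *\<^sub>v x) $ i = 0"
proof -
  have carr: "U \<in> carrier_mat n n" "V \<in> carrier_mat n n"
    using U V by (auto simp: unitary_mat_def)
  define c where "c i = (if i < k then row (mat_adjoint V) i else row (mat_adjoint U) i)" for i
  define C where "C = mat\<^sub>r n n (\<lambda>i. if i = k then 0\<^sub>v n else c i)"
  have "det C = 0"
    unfolding C_def by (rule det_row_0[OF k]) (use carr in \<open>auto simp: c_def\<close>)
  moreover have C: "C \<in> carrier_mat n n" by (simp add: C_def)
  ultimately obtain x where x: "x \<in> carrier_vec n" "x \<noteq> 0\<^sub>v n" "C *\<^sub>v x = 0\<^sub>v n"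
    using det_0_iff_vec_prod_zero[OF C] by blast
  have "c i \<bullet> x = 0" if "i < n" "i \<noteq> k" for i
  proof -
    have "row C i = c i"
      using that carr by (auto simp: C_def c_def intro!: eq_vecI)
    then show ?thesis
      using arg_cong[OF x(3), of "\<lambda>v. v $ i"] that C by simp
  qed
  note * = this
  show ?thesis
  proof (rule that[OF x(1,2)])
    show "(mat_adjoint V *\<^sub>v x) $ i = 0" if "i < k" for i
      using *[of i] that k carr by (simp add: c_def)
    show "(mat_adjoint U *\<^sub>v x) $ i = 0" if "k < i" "i < n" for i
      using *[of i] that k carr by (simp add: c_def)
  qed
qed

text \<open>
  On the vector \<open>x\<close> of \<open>separating_vector\<close>, the form of \<open>B\<close> involves only the eigenvalues
  \<open>e i\<close> with \<open>i \<ge> k\<close> and the form of \<open>A\<close> only those \<open>d i\<close> with \<open>i \<le> k\<close>, so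
  \<open>e k * r \<le> x\<^sup>* B x \<le> x\<^sup>* A x \<le> d k * r\<close>, where \<open>r > 0\<close> is the squared norm of \<open>x\<close>.
\<close>

theorem weyl_monotonicity:
  assumes U: "unitary_mat n U" and A: "A = U * mat_diag n (\<lambda>i. complex_of_real (d i)) * mat_adjoint U"
    and V: "unitary_mat n V" and B: "B = V * mat_diag n (\<lambda>i. complex_of_real (e i)) * mat_adjoint V"
    and d: "\<And>i j. i \<le> j \<Longrightarrow> j < n \<Longrightarrow> d i \<le> d j"
    and e: "\<And>i j. i \<le> j \<Longrightarrow> j < n \<Longrightarrow> e i \<le> e j"
    and AB: "loewner_ge n A B" and k: "k < n"
  shows "e k \<le> d k"
proof -
  obtain x where x: "x \<in> carrier_vec n" "x \<noteq> 0\<^sub>v n"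
    and Vx: "\<And>i. i < k \<Longrightarrow> (mat_adjoint V *\<^sub>v x) $ i = 0"
    and Ux: "\<And>i. k < i \<Longrightarrow> i < n \<Longrightarrow> (mat_adjoint U *\<^sub>v x) $ i = 0"
    using separating_vector[OF U V k] by metis
  let ?u = "\<lambda>i. (cmod ((mat_adjoint U *\<^sub>v x) $ i))\<^sup>2"
  let ?v = "\<lambda>i. (cmod ((mat_adjoint V *\<^sub>v x) $ i))\<^sup>2"
  define r where "r = (\<Sum>i<n. (cmod (x $ i))\<^sup>2)"
  have "x \<bullet>c x \<noteq> 0" using x by simp
  then have "r \<noteq> 0" using x by (auto simp: scalar_prod_self_conjugate r_def simp del: of_real_sum)
  moreover have "r \<ge> 0" by (simp add: r_def sum_nonneg)
  ultimately have r: "r > 0" by simp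
  have carr: "A \<in> carrier_mat n n" "B \<in> carrier_mat n n"
    using U V unfolding A B by (auto simp: unitary_mat_def)
  have "((A - B) *\<^sub>v x) \<bullet>c x = (A *\<^sub>v x) \<bullet>c x - (B *\<^sub>v x) \<bullet>c x"
    using carr x by (simp add: minus_mult_distrib_mat_vec minus_scalar_prod_distrib[of _ n])
  also have "\<dots> = of_real ((\<Sum>i<n. d i * ?u i) - (\<Sum>i<n. e i * ?v i))"
    by (simp only: quadratic_form_diagonalized[OF U x(1) A]
        quadratic_form_diagonalized[OF V x(1) B] of_real_diff)
  finally have "0 \<le> complex_of_real ((\<Sum>i<n. d i * ?u i) - (\<Sum>i<n. e i * ?v i))"
    using AB x(1) unfolding loewner_ge_def by metis
  then have "(\<Sum>i<n. e i * ?v i) \<le> (\<Sum>i<n. d i * ?u i)"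
    by (simp only: less_eq_complex_def Re_complex_of_real zero_complex.sel) simp
  moreover have "e k * r \<le> (\<Sum>i<n. e i * ?v i)"
  proof -
    have "e k * ?v i \<le> e i * ?v i" if "i < n" for i
      using Vx[of i] e[of k i] that by (cases "i < k") (auto intro: mult_right_mono)
    then have "(\<Sum>i<n. e k * ?v i) \<le> (\<Sum>i<n. e i * ?v i)" by (intro sum_mono) simp
    then show ?thesis by (simp only: r_def flip: unitary_norm[OF V x(1)] sum_distrib_left)
  qed
  moreover have "(\<Sum>i<n. d i * ?u i) \<le> d k * r"
  proof -
    have "d i * ?u i \<le> d k * ?u i" if "i < n" for i
      using Ux[of i] d[of i k] that k by (cases "k < i") (auto intro: mult_right_mono)
    then have "(\<Sum>i<n. d i * ?u i) \<le> (\<Sum>i<n. d k * ?u i)" by (intro sum_mono) simp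
    then show ?thesis by (simp only: r_def flip: unitary_norm[OF U x(1)] sum_distrib_left)
  qed
  ultimately have "e k * r \<le> d k * r" by linarith
  with r show ?thesis by simp
qed

text \<open>
  An arbitrary diagonalization, with \<open>P\<close> and \<open>Q\<close> not unitary, still reveals the
  characteristic polynomial, hence the eigenvalues with their multiplicities; sorting them and
  diagonalizing again yields a unitary diagonalization with the same eigenvalues up to a permutation.
\<close>

lemma sorted_diagonalization:
  assumes A: "A \<in> carrier_mat n n" "mat_adjoint A = A"
    and sim: "similar_mat_wit A (mat_diag n (\<lambda>k. complex_of_real (ev k))) P Q"
  obtains U d p where "unitary_mat n U"
    "A = U * mat_diag n (\<lambda>i. complex_of_real (d i)) * mat_adjoint U"
    "\<And>i j. i \<le> j \<Longrightarrow> j < n \<Longrightarrow> d i \<le> d j"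
    "p permutes {..<n}" "\<And>i. i < n \<Longrightarrow> d i = ev (p i)"
proof -
  define xs where "xs = map ev [0..<n]"
  define ys where "ys = sort xs"
  have ys: "mset ys = mset xs" "length ys = n" by (auto simp: ys_def xs_def)
  obtain p where p: "p permutes {..<length xs}" "permute_list p xs = ys"
    using mset_eq_permutation[OF ys(1)] .
  let ?D = "mat_diag n (\<lambda>k. complex_of_real (ev k))"
  have "char_poly A = char_poly ?D"
    using sim by (intro char_poly_similar) (auto simp: similar_mat_def)
  also have "\<dots> = (\<Prod>a\<leftarrow>diag_mat ?D. [:- a, 1:])"
    by (rule char_poly_upper_triangular[of _ n]) (auto simp: mat_diag_def)
  also have "diag_mat ?D = map of_real xs"
    by (auto simp: diag_mat_def mat_diag_def xs_def)
  also have "(\<Prod>a\<leftarrow>map of_real xs. [:- a, 1:]) = (\<Prod>a\<leftarrow>map complex_of_real ys. [:- a, 1:])"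
    by (simp only: prod_mset_prod_list[symmetric] mset_map ys)
  finally obtain U where U: "unitary_mat n U"
    "A = U * mat_diag n (\<lambda>i. map complex_of_real ys ! i) * mat_adjoint U"
    using hermitian_diagonalization[OF A] by blast
  have eq: "mat_diag n (\<lambda>i. map complex_of_real ys ! i) = mat_diag n (\<lambda>i. complex_of_real (ys ! i))"
    by (rule eq_matI) (auto simp: mat_diag_def ys)
  show ?thesis
  proof (rule that[OF U(1) U(2)[unfolded eq]])
    show "ys ! i \<le> ys ! j" if "i \<le> j" "j < n" for i j
      using that ys by (auto simp: ys_def intro: sorted_nth_mono)
    show "p permutes {..<n}" using p by (simp add: xs_def)
    then show "ys ! i = ev (p i)" if "i < n" for i
      using p that permute_list_nth[of p xs i] permutes_in_image[of p "{..<n}" i]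
      by (auto simp: xs_def)
  qed
qed

lemma loewner_ge_eigenvalue_matching:
  assumes A: "A \<in> carrier_mat n n" "mat_adjoint A = A"
    and simA: "similar_mat_wit A (mat_diag n (\<lambda>k. complex_of_real (a k))) P Q"
    and B: "B \<in> carrier_mat n n" "mat_adjoint B = B"
    and simB: "similar_mat_wit B (mat_diag n (\<lambda>k. complex_of_real (b k))) P' Q'"
    and AB: "loewner_ge n A B"
  obtains p where "p permutes {..<n}" "\<And>k. k < n \<Longrightarrow> b k \<le> a (p k)"
proof -
  obtain U d p where U: "unitary_mat n U"
      "A = U * mat_diag n (\<lambda>i. complex_of_real (d i)) * mat_adjoint U"
    and d: "\<And>i j. i \<le> j \<Longrightarrow> j < n \<Longrightarrow> d i \<le> d j"
    and p: "p permutes {..<n}" "\<And>i. i < n \<Longrightarrow> d i = a (p i)"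
    using sorted_diagonalization[OF A simA] by metis
  obtain V e q where V: "unitary_mat n V"
      "B = V * mat_diag n (\<lambda>i. complex_of_real (e i)) * mat_adjoint V"
    and e: "\<And>i j. i \<le> j \<Longrightarrow> j < n \<Longrightarrow> e i \<le> e j"
    and q: "q permutes {..<n}" "\<And>i. i < n \<Longrightarrow> e i = b (q i)"
    using sorted_diagonalization[OF B simB] by metis
  show ?thesis
  proof (rule that)
    show "p \<circ> Hilbert_Choice.inv q permutes {..<n}"
      by (rule permutes_compose[OF permutes_inv[OF q(1)] p(1)])
    show "b k \<le> a ((p \<circ> Hilbert_Choice.inv q) k)" if "k < n" for k
    proof -
      have "Hilbert_Choice.inv q k < n"
        using permutes_in_image[OF permutes_inv[OF q(1)], of k] that by simp
      moreover from this have "e (Hilbert_Choice.inv q k) \<le> d (Hilbert_Choice.inv q k)"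
        by (intro weyl_monotonicity[OF U V _ _ AB] d e)
      ultimately show ?thesis
        using p(2) q(2) permutes_inverses(1)[OF q(1)] by simp
    qed
  qed
qed

section \<open>The trace of a matrix function\<close>

lemma mat_trace_mult_comm:
  assumes "A \<in> carrier_mat n m" "B \<in> carrier_mat m n"
  shows "mat_trace (A * B) = mat_trace (B * A)"
proof -
  have "mat_trace (A * B) = (\<Sum>i<n. \<Sum>j<m. A $$ (i, j) * B $$ (j, i))"
    using assms by (simp add: mat_trace_def scalar_prod_def atLeast0LessThan)
  also have "\<dots> = (\<Sum>j<m. \<Sum>i<n. A $$ (i, j) * B $$ (j, i))"
    by (rule sum.swap)
  also have "\<dots> = mat_trace (B * A)"
    using assms by (simp add: mat_trace_def scalar_prod_def atLeast0LessThan mult.commute)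
  finally show ?thesis .
qed

lemma dim_kronecker [simp]:
  "dim_row (kronecker A B) = dim_row A * dim_row B"
  "dim_col (kronecker A B) = dim_col A * dim_col B"
  by (auto simp: kronecker_def)

text \<open>
  The index \<open>k < b * q\<close> of a Kronecker product stands for the pair \<open>(k div q, k mod q)\<close>.
\<close>

lemma sum_div_mod:
  fixes f :: "nat \<Rightarrow> nat \<Rightarrow> complex"
  shows "(\<Sum>k<b * q. f (k div q) (k mod q)) = (\<Sum>u<b. \<Sum>v<q. f u v)"
proof -
  have "(\<Sum>k<b * q. f (k div q) (k mod q)) = (\<Sum>u<b. \<Sum>k\<in>{u * q..<u * q + q}. f (k div q) (k mod q))"
    by (rule sum.nat_group[symmetric])
  also have "\<dots> = (\<Sum>u<b. \<Sum>v<q. f u v)"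
  proof (rule sum.cong[OF refl])
    fix u
    have "(\<Sum>k\<in>{u * q..<u * q + q}. f (k div q) (k mod q))
        = (\<Sum>v<q. f ((v + u * q) div q) ((v + u * q) mod q))"
      using sum.shift_bounds_nat_ivl[of "\<lambda>k. f (k div q) (k mod q)" 0 "u * q" q]
      by (simp add: add.commute atLeast0LessThan)
    then show "(\<Sum>k\<in>{u * q..<u * q + q}. f (k div q) (k mod q)) = (\<Sum>v<q. f u v)"
      by simp
  qed
  finally show ?thesis .
qed

lemma kronecker_mixed_product:
  assumes "A \<in> carrier_mat a b" "C \<in> carrier_mat b c" "B \<in> carrier_mat p q" "D \<in> carrier_mat q r"
  shows "kronecker A B * kronecker C D = kronecker (A * C) (B * D)"
proof (rule eq_matI)
  fix i j assume "i < dim_row (kronecker (A * C) (B * D))" "j < dim_col (kronecker (A * C) (B * D))"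
  then have ij: "i < a * p" "j < c * r" using assms by auto
  then have pr: "p > 0" "r > 0" by (auto intro: gr0I)
  have lt: "i div p < a" "i mod p < p" "j div r < c" "j mod r < r"
    using ij pr by (auto simp: less_mult_imp_div_less)
  have "(kronecker A B * kronecker C D) $$ (i, j)
      = (\<Sum>k<b * q. (A $$ (i div p, k div q) * B $$ (i mod p, k mod q)) *
                    (C $$ (k div q, j div r) * D $$ (k mod q, j mod r)))"
    using assms ij by (simp add: scalar_prod_def kronecker_def atLeast0LessThan)
  also have "\<dots> = (\<Sum>u<b. \<Sum>v<q. (A $$ (i div p, u) * B $$ (i mod p, v)) * (C $$ (u, j div r) * D $$ (v, j mod r)))"
    by (rule sum_div_mod)
  also have "\<dots> = (\<Sum>u<b. A $$ (i div p, u) * C $$ (u, j div r)) * (\<Sum>v<q. B $$ (i mod p, v) * D $$ (v, j mod r))"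
    by (simp add: sum_product mult_ac)
  also have "\<dots> = kronecker (A * C) (B * D) $$ (i, j)"
    using assms ij lt by (simp add: scalar_prod_def kronecker_def atLeast0LessThan)
  finally show "(kronecker A B * kronecker C D) $$ (i, j) = kronecker (A * C) (B * D) $$ (i, j)" .
qed (use assms in auto)

lemma kronecker_one: "kronecker (1\<^sub>m a) (1\<^sub>m b) = 1\<^sub>m (a * b)"
proof (rule eq_matI)
  fix i j assume "i < dim_row (1\<^sub>m (a * b) :: complex mat)" "j < dim_col (1\<^sub>m (a * b) :: complex mat)"
  then have ij: "i < a * b" "j < a * b" by auto
  then have "b > 0" by (auto intro: gr0I)
  then have lt: "i div b < a" "i mod b < b" "j div b < a" "j mod b < b"
    using ij by (auto simp: less_mult_imp_div_less)
  have "i = j \<longleftrightarrow> i div b = j div b \<and> i mod b = j mod b"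
    by (metis div_mult_mod_eq)
  then show "kronecker (1\<^sub>m a) (1\<^sub>m b) $$ (i, j) = 1\<^sub>m (a * b) $$ (i, j)"
    using ij lt by (auto simp: kronecker_def)
qed auto

lemma kronecker_prod_carrier:
  assumes "\<And>j. j < m \<Longrightarrow> P j \<in> carrier_mat n n"
  shows "kronecker_prod m P \<in> carrier_mat (n ^ m) (n ^ m)"
  using assms
proof (induction m)
  case (Suc m)
  then have "kronecker_prod m P \<in> carrier_mat (n ^ m) (n ^ m)" "P m \<in> carrier_mat n n" by auto
  then show ?case by (auto simp: mult.commute)
qed simp

lemma kronecker_prod_inverse:
  assumes "\<And>j. j < m \<Longrightarrow> P j \<in> carrier_mat n n" "\<And>j. j < m \<Longrightarrow> Q j \<in> carrier_mat n n"
    and "\<And>j. j < m \<Longrightarrow> Q j * P j = 1\<^sub>m n"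
  shows "kronecker_prod m Q * kronecker_prod m P = 1\<^sub>m (n ^ m)"
  using assms
proof (induction m)
  case (Suc m)
  have "kronecker_prod (Suc m) Q * kronecker_prod (Suc m) P
      = kronecker (kronecker_prod m Q * kronecker_prod m P) (Q m * P m)"
    using Suc.prems kronecker_prod_carrier[of m Q n] kronecker_prod_carrier[of m P n]
    by (simp add: kronecker_mixed_product[of _ "n ^ m" "n ^ m" _ "n ^ m" _ n n _ n])
  with Suc show ?case by (simp add: kronecker_one mult.commute)
qed simp

text \<open>
  A number below \<open>n ^ m\<close> is determined by its \<open>m\<close> base-\<open>n\<close> digits; surjectivity follows because
  both sides have \<open>n ^ m\<close> elements.
\<close>

lemma bij_betw_lex_index:
  "bij_betw (\<lambda>a. \<lambda>j\<in>{..<m}. lex_index m n a j) {..<n ^ m} (PiE {..<m} (\<lambda>_. {..<n}))"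
proof -
  let ?h = "\<lambda>a. \<lambda>j\<in>{..<m}. lex_index m n a j"
  have inj: "a = b"
    if "a < n ^ m" "b < n ^ m" "\<And>j. j < m \<Longrightarrow> lex_index m n a j = lex_index m n b j" for a b
    using that
  proof (induction m arbitrary: a b)
    case (Suc m)
    \<comment> \<open>The most significant digit has index \<open>0\<close>, so dropping the last digit keeps the indices.\<close>
    have rec: "lex_index (Suc m) n c j = lex_index m n (c div n) j" if "j < m" for c j
    proof -
      have "Suc m - 1 - j = Suc (m - 1 - j)" using that by simp
      then show ?thesis by (simp only: lex_index_def power_Suc div_mult2_eq)
    qed
    have "a div n = b div n"
    proof (rule Suc.IH)
      show "a div n < n ^ m" "b div n < n ^ m"
        using Suc.prems by (auto intro!: less_mult_imp_div_less simp: mult.commute)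
      show "lex_index m n (a div n) j = lex_index m n (b div n) j" if "j < m" for j
        using Suc.prems(3)[of j] that by (simp add: rec)
    qed
    moreover have "a mod n = b mod n"
      using Suc.prems(3)[of m] by (simp add: lex_index_def)
    ultimately show ?case by (metis div_mult_mod_eq)
  qed simp
  have "inj_on ?h {..<n ^ m}"
  proof (rule inj_onI)
    fix a b assume ab: "a \<in> {..<n ^ m}" "b \<in> {..<n ^ m}" "?h a = ?h b"
    have "lex_index m n a j = lex_index m n b j" if "j < m" for j
      using fun_cong[OF ab(3), of j] that by simp
    then show "a = b" by (rule inj[rotated 2]) (use ab in auto)
  qed
  moreover have "?h ` {..<n ^ m} \<subseteq> PiE {..<m} (\<lambda>_. {..<n})"
  proof
    fix g assume "g \<in> ?h ` {..<n ^ m}"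
    then obtain a where a: "a < n ^ m" and g: "g = ?h a" by blast
    have "lex_index m n a j < n" if "j < m" for j
    proof -
      have "n > 0" using a that by (cases n; cases m) auto
      then show ?thesis by (simp add: lex_index_def)
    qed
    then show "g \<in> PiE {..<m} (\<lambda>_. {..<n})" by (simp add: g)
  qed
  moreover have "card (PiE {..<m} (\<lambda>_. {..<n})) = n ^ m"
    by (simp add: card_PiE)
  ultimately show ?thesis
    unfolding bij_betw_def by (metis card_image card_lessThan card_subset_eq finite_PiE finite_lessThan)
qed

lemma mat_trace_is_matrix_fun:
  assumes "is_matrix_fun m n S f M F"
  obtains P Q ev where
    "\<forall>j<m. similar_mat_wit (M j) (mat_diag n (\<lambda>k. complex_of_real (ev j k))) (P j) (Q j)"
    "\<forall>j<m. \<forall>k<n. ev j k \<in> S j"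
    "mat_trace F = of_real (\<Sum>g\<in>PiE {..<m} (\<lambda>_. {..<n}). f (\<lambda>j\<in>{..<m}. ev j (g j)))"
proof -
  obtain P Q ev where M: "\<And>j. j < m \<Longrightarrow> M j \<in> carrier_mat n n"
    and sim: "\<And>j. j < m \<Longrightarrow> similar_mat_wit (M j) (mat_diag n (\<lambda>k. complex_of_real (ev j k))) (P j) (Q j)"
    and S: "\<And>j k. j < m \<Longrightarrow> k < n \<Longrightarrow> ev j k \<in> S j"
    and F: "F = kronecker_prod m P
       * mat_diag (n ^ m) (\<lambda>a. complex_of_real (f (\<lambda>j\<in>{..<m}. ev j (lex_index m n a j))))
       * kronecker_prod m Q"
    using assms unfolding is_matrix_fun_def by blast
  note PQ = similar_mat_witD2[OF M sim]
  let ?N = "n ^ m" and ?K = "kronecker_prod m P" and ?L = "kronecker_prod m Q"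
  let ?D = "mat_diag ?N (\<lambda>a. complex_of_real (f (\<lambda>j\<in>{..<m}. ev j (lex_index m n a j))))"
  have c: "?K \<in> carrier_mat ?N ?N" "?L \<in> carrier_mat ?N ?N" "?D \<in> carrier_mat ?N ?N"
    using PQ by (auto intro: kronecker_prod_carrier)
  have LK: "?L * ?K = 1\<^sub>m ?N" by (rule kronecker_prod_inverse) (use PQ in auto)
  have "mat_trace F = mat_trace (?L * (?K * ?D))"
    unfolding F using c by (intro mat_trace_mult_comm[of _ ?N ?N]) auto
  also have "?L * (?K * ?D) = (?L * ?K) * ?D"
    using c by (simp add: assoc_mult_mat[of _ ?N ?N _ ?N _ ?N])
  also have "\<dots> = ?D" using LK left_mult_one_mat[OF c(3)] by simp
  also have "mat_trace ?D = of_real (\<Sum>a<?N. f (\<lambda>j\<in>{..<m}. ev j (lex_index m n a j)))"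
    by (simp add: mat_trace_def mat_diag_def)
  also have "(\<Sum>a<?N. f (\<lambda>j\<in>{..<m}. ev j (lex_index m n a j)))
      = (\<Sum>a<?N. f (\<lambda>j\<in>{..<m}. ev j ((\<lambda>j\<in>{..<m}. lex_index m n a j) j)))"
    by (intro sum.cong refl arg_cong[where f = f]) (auto simp: restrict_def)
  also have "\<dots> = (\<Sum>g\<in>PiE {..<m} (\<lambda>_. {..<n}). f (\<lambda>j\<in>{..<m}. ev j (g j)))"
    by (rule sum.reindex_bij_betw[OF bij_betw_lex_index])
  finally have tr: "mat_trace F
      = of_real (\<Sum>g\<in>PiE {..<m} (\<lambda>_. {..<n}). f (\<lambda>j\<in>{..<m}. ev j (g j)))" .
  show ?thesis by (rule that[OF _ _ tr, of P Q]) (simp_all add: sim S)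
qed

text \<open>
  This makes the choice in the definition of \<open>matrix_fun\<close> meaningful for Hermitian arguments.
\<close>

lemma is_matrix_fun_exists:
  assumes "\<And>j. j < m \<Longrightarrow> M j \<in> herm_mats n (S j)"
  shows "\<exists>F. is_matrix_fun m n S f M F"
proof -
  have "\<exists>U ev. similar_mat_wit (M j) (mat_diag n (\<lambda>k. complex_of_real (ev k))) U (mat_adjoint U)
      \<and> (\<forall>k<n. ev k \<in> S j)" if "j < m" for j
  proof -
    have A: "M j \<in> carrier_mat n n" "mat_adjoint (M j) = M j"
      and S: "\<And>z. eigenvalue (M j) z \<Longrightarrow> z \<in> complex_of_real ` S j"
      using assms[OF that] by (auto simp: herm_mats_def)
    obtain es where es: "char_poly (M j) = (\<Prod>e\<leftarrow>es. [:- e, 1:])" "length es = n"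
      using char_poly_factorized[OF A(1)] by blast
    have "poly (\<Prod>e\<leftarrow>es. [:- e, 1:]) z = 0" if "z \<in> set es" for z
      using that by (induction es) auto
    then have mem: "es ! k \<in> complex_of_real ` S j" if "k < n" for k
      using S[of "es ! k"] that es by (simp add: eigenvalue_root_char_poly[OF A(1)])
    obtain U where U: "unitary_mat n U" "M j = U * mat_diag n (\<lambda>i. es ! i) * mat_adjoint U"
      using hermitian_diagonalization[OF A es(1)] by blast
    \<comment> \<open>The eigenvalues lie in \<open>S j\<close>, so taking real parts does not change them.\<close>
    have eq: "mat_diag n (\<lambda>i. es ! i) = mat_diag n (\<lambda>k. complex_of_real (Re (es ! k)))"
    proof (rule eq_matI)
      fix i k
      assume ik: "i < dim_row (mat_diag n (\<lambda>k. complex_of_real (Re (es ! k))))"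
        "k < dim_col (mat_diag n (\<lambda>k. complex_of_real (Re (es ! k))))"
      then have "k < n" by (simp add: mat_diag_def)
      from mem[OF this] show "mat_diag n (\<lambda>i. es ! i) $$ (i, k) =
          mat_diag n (\<lambda>k. complex_of_real (Re (es ! k))) $$ (i, k)"
        using ik by (auto simp: mat_diag_def)
    qed (auto simp: mat_diag_def)
    have "similar_mat_wit (M j) (mat_diag n (\<lambda>k. complex_of_real (Re (es ! k)))) U (mat_adjoint U)"
      using U A(1) unfolding eq by (intro similar_mat_witI[of _ _ n]) (auto simp: unitary_mat_def)
    moreover have "\<forall>k<n. Re (es ! k) \<in> S j" using mem by (metis Re_complex_of_real imageE)
    ultimately show ?thesis by (intro exI[of _ U] exI[of _ "\<lambda>k. Re (es ! k)"]) simp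
  qed
  then obtain U ev where "\<And>j. j < m \<Longrightarrow>
      similar_mat_wit (M j) (mat_diag n (\<lambda>k. complex_of_real (ev j k))) (U j) (mat_adjoint (U j))
      \<and> (\<forall>k<n. ev j k \<in> S j)"
    by metis
  moreover have "\<And>j. j < m \<Longrightarrow> M j \<in> carrier_mat n n"
    using assms by (auto simp: herm_mats_def)
  ultimately show ?thesis
    unfolding is_matrix_fun_def
    by (intro exI[of _ U] exI[of _ "\<lambda>j. mat_adjoint (U j)"] exI[of _ ev] exI conjI[OF _ refl]) simp
qed

section \<open>Monotonicity of the trace\<close>

text \<open>
  Monotonicity in each variable separately gives monotonicity in all of them, by passing from \<open>x\<close>
  to \<open>y\<close> one coordinate at a time; the intermediate points stay in the box.
\<close>

lemma incr_in_each_mono: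
  assumes f: "incr_in_each m S f" and x: "x \<in> PiE {..<m} S" and y: "y \<in> PiE {..<m} S"
    and xy: "\<And>j. j < m \<Longrightarrow> x j \<le> y j"
  shows "f x \<le> f y"
proof -
  define z where "z k = (\<lambda>j. if j < k then y j else x j)" for k :: nat
  have "f x \<le> f (z k)" if "k \<le> m" for k
    using that
  proof (induction k)
    case (Suc k)
    have "z k \<in> PiE {..<m} S"
      using x y Suc.prems by (auto simp: z_def PiE_iff extensional_def)
    moreover have "z k k \<le> y k" "y k \<in> S k" "k < m"
      using xy y Suc.prems by (auto simp: z_def)
    ultimately have "f (z k) \<le> f ((z k)(k := y k))"
      using f unfolding incr_in_each_def by blast
    also have "(z k)(k := y k) = z (Suc k)" by (auto simp: z_def less_Suc_eq)
    finally show ?case using Suc by simp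
  qed (simp add: z_def)
  from this[of m] have "f x \<le> f (z m)" by simp
  also have "z m = y"
    using x y by (intro ext) (auto simp: z_def PiE_iff extensional_def)
  finally show ?thesis .
qed

lemma bij_betw_PiE_permute:
  assumes p: "\<And>j. j < m \<Longrightarrow> p j permutes {..<n::nat}"
  shows "bij_betw (\<lambda>g. \<lambda>j\<in>{..<m}. p j (g j)) (PiE {..<m::nat} (\<lambda>_. {..<n})) (PiE {..<m} (\<lambda>_. {..<n}))"
proof (rule bij_betw_byWitness[where f' = "\<lambda>g. \<lambda>j\<in>{..<m}. Hilbert_Choice.inv (p j) (g j)"])
  let ?X = "PiE {..<m} (\<lambda>_. {..<n})"
  have pn: "p j k < n \<longleftrightarrow> k < n" "Hilbert_Choice.inv (p j) k < n \<longleftrightarrow> k < n" if "j < m" for j k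
    using permutes_in_image[OF p[OF that], of k]
      permutes_in_image[OF permutes_inv[OF p[OF that]], of k] by auto
  show "\<forall>g\<in>?X. (\<lambda>j\<in>{..<m}. Hilbert_Choice.inv (p j) ((\<lambda>j\<in>{..<m}. p j (g j)) j)) = g"
    using permutes_inverses(2)[OF p] by (auto simp: restrict_def PiE_iff extensional_def)
  show "\<forall>g\<in>?X. (\<lambda>j\<in>{..<m}. p j ((\<lambda>j\<in>{..<m}. Hilbert_Choice.inv (p j) (g j)) j)) = g"
    using permutes_inverses(1)[OF p] by (auto simp: restrict_def PiE_iff extensional_def)
  show "(\<lambda>g. \<lambda>j\<in>{..<m}. p j (g j)) ` ?X \<subseteq> ?X" "(\<lambda>g. \<lambda>j\<in>{..<m}. Hilbert_Choice.inv (p j) (g j)) ` ?X \<subseteq> ?X"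
    using pn by (auto simp: PiE_iff)
qed

lemma trace_sum_mono:
  fixes a b :: "nat \<Rightarrow> nat \<Rightarrow> real"
  assumes f: "incr_in_each m S f"
    and aS: "\<And>j k. j < m \<Longrightarrow> k < n \<Longrightarrow> a j k \<in> S j"
    and bS: "\<And>j k. j < m \<Longrightarrow> k < n \<Longrightarrow> b j k \<in> S j"
    and p: "\<And>j. j < m \<Longrightarrow> p j permutes {..<n}"
    and ab: "\<And>j k. j < m \<Longrightarrow> k < n \<Longrightarrow> b j k \<le> a j (p j k)"
  shows "(\<Sum>g\<in>PiE {..<m} (\<lambda>_. {..<n}). f (\<lambda>j\<in>{..<m}. b j (g j)))
    \<le> (\<Sum>g\<in>PiE {..<m} (\<lambda>_. {..<n}). f (\<lambda>j\<in>{..<m}. a j (g j)))"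
proof -
  let ?X = "PiE {..<m} (\<lambda>_. {..<n})"
  have "(\<Sum>g\<in>?X. f (\<lambda>j\<in>{..<m}. b j (g j)))
      \<le> (\<Sum>g\<in>?X. f (\<lambda>j\<in>{..<m}. a j ((\<lambda>j\<in>{..<m}. p j (g j)) j)))"
  proof (intro sum_mono incr_in_each_mono[OF f])
    fix g assume g: "g \<in> ?X"
    then have gn: "g j < n" if "j < m" for j using that by auto
    then have pn: "p j (g j) < n" if "j < m" for j
      using permutes_in_image[OF p[OF that], of "g j"] that by auto
    show "(\<lambda>j\<in>{..<m}. b j (g j)) \<in> PiE {..<m} S" using gn bS by auto
    show "(\<lambda>j\<in>{..<m}. a j ((\<lambda>j\<in>{..<m}. p j (g j)) j)) \<in> PiE {..<m} S" using pn aS by auto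
    show "(\<lambda>j\<in>{..<m}. b j (g j)) j \<le> (\<lambda>j\<in>{..<m}. a j ((\<lambda>j\<in>{..<m}. p j (g j)) j)) j"
      if "j < m" for j using ab gn that by simp
  qed
  also have "\<dots> = (\<Sum>g\<in>?X. f (\<lambda>j\<in>{..<m}. a j (g j)))"
    by (rule sum.reindex_bij_betw[OF bij_betw_PiE_permute[OF p]])
  finally show ?thesis .
qed

lemma loewner_ge_trace_sums:
  assumes M: "\<And>l. l < m \<Longrightarrow> M l \<in> herm_mats n (S l)"
    and N: "\<And>l. l < m \<Longrightarrow> N l \<in> herm_mats n (S l)"
    and MN: "\<And>l. l < m \<Longrightarrow> loewner_ge n (M l) (N l)"
  obtains s t where
    "mat_trace (matrix_fun m n S f M) = complex_of_real s"
    "mat_trace (matrix_fun m n S f N) = complex_of_real t"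
    "incr_in_each m S f \<Longrightarrow> t \<le> s" "decr_in_each m S f \<Longrightarrow> s \<le> t"
proof -
  let ?s = "\<lambda>f ev. \<Sum>g\<in>PiE {..<m} (\<lambda>_. {..<n}). f (\<lambda>j\<in>{..<m}. ev j (g j)) :: real"
  have mf: "is_matrix_fun m n S f L (matrix_fun m n S f L)"
    if "\<And>l. l < m \<Longrightarrow> L l \<in> herm_mats n (S l)" for L
    unfolding matrix_fun_def by (rule someI_ex[OF is_matrix_fun_exists[OF that]])
  obtain P Q a where
    simM: "\<forall>j<m. similar_mat_wit (M j) (mat_diag n (\<lambda>k. complex_of_real (a j k))) (P j) (Q j)"
    and aS: "\<forall>j<m. \<forall>k<n. a j k \<in> S j"
    and trM: "mat_trace (matrix_fun m n S f M) = of_real (?s f a)"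
    by (rule mat_trace_is_matrix_fun[OF mf[OF M]])
  obtain P' Q' b where
    simN: "\<forall>j<m. similar_mat_wit (N j) (mat_diag n (\<lambda>k. complex_of_real (b j k))) (P' j) (Q' j)"
    and bS: "\<forall>j<m. \<forall>k<n. b j k \<in> S j"
    and trN: "mat_trace (matrix_fun m n S f N) = of_real (?s f b)"
    by (rule mat_trace_is_matrix_fun[OF mf[OF N]])
  have "\<exists>p. p permutes {..<n} \<and> (\<forall>k<n. b j k \<le> a j (p k))" if "j < m" for j
    by (rule loewner_ge_eigenvalue_matching[OF _ _ simM[rule_format, OF that] _ _ simN[rule_format, OF that] MN[OF that]])
      (use M[OF that] N[OF that] in \<open>auto simp: herm_mats_def\<close>)
  then obtain p where p: "\<And>j. j < m \<Longrightarrow> p j permutes {..<n}"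
    and ab: "\<And>j k. j < m \<Longrightarrow> k < n \<Longrightarrow> b j k \<le> a j (p j k)"
    by metis
  have mono: "?s h b \<le> ?s h a" if "incr_in_each m S h" for h
    by (rule trace_sum_mono[where p = p, OF that]) (use aS bS p ab in auto)
  show ?thesis
  proof (rule that[OF trM trN])
    show "incr_in_each m S f \<Longrightarrow> ?s f b \<le> ?s f a" by (rule mono)
    show "?s f a \<le> ?s f b" if "decr_in_each m S f"
    proof -
      have "incr_in_each m S (\<lambda>x. - f x)"
        using that by (auto simp: incr_in_each_def decr_in_each_def)
      from mono[OF this] show ?thesis by (simp add: sum_negf)
    qed
  qed
qed

theorem proposition2p3:
  fixes m n :: nat
    and S :: "nat \<Rightarrow> real set"
    and f :: "(nat \<Rightarrow> real) \<Rightarrow> real"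
  assumes "m \<ge> 1" and "n \<ge> 1"
    and "\<forall>j<m. convex (S j)"
    and "class_C m m S f"
  shows "(incr_in_each m S f \<longrightarrow>
           (\<forall>M N. (\<forall>l<m. M l \<in> herm_mats n (S l)) \<and> (\<forall>l<m. N l \<in> herm_mats n (S l)) \<and>
                  (\<forall>l<m. loewner_ge n (M l) (N l)) \<longrightarrow>
              mat_trace (matrix_fun m n S f M) \<ge> mat_trace (matrix_fun m n S f N)))
       \<and> (decr_in_each m S f \<longrightarrow>
           (\<forall>M N. (\<forall>l<m. M l \<in> herm_mats n (S l)) \<and> (\<forall>l<m. N l \<in> herm_mats n (S l)) \<and>
                  (\<forall>l<m. loewner_ge n (M l) (N l)) \<longrightarrow>
              mat_trace (matrix_fun m n S f M) \<le> mat_trace (matrix_fun m n S f N)))"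
proof (intro conjI impI allI)
  fix M N
  assume f: "incr_in_each m S f" and MN: "(\<forall>l<m. M l \<in> herm_mats n (S l)) \<and>
    (\<forall>l<m. N l \<in> herm_mats n (S l)) \<and> (\<forall>l<m. loewner_ge n (M l) (N l))"
  show "mat_trace (matrix_fun m n S f M) \<ge> mat_trace (matrix_fun m n S f N)"
    by (rule loewner_ge_trace_sums[of m M n S N f]) (use MN f in \<open>auto simp: less_eq_complex_def\<close>)
next
  fix M N
  assume f: "decr_in_each m S f" and MN: "(\<forall>l<m. M l \<in> herm_mats n (S l)) \<and>
    (\<forall>l<m. N l \<in> herm_mats n (S l)) \<and> (\<forall>l<m. loewner_ge n (M l) (N l))"
  show "mat_trace (matrix_fun m n S f M) \<le> mat_trace (matrix_fun m n S f N)"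
    by (rule loewner_ge_trace_sums[of m M n S N f]) (use MN f in \<open>auto simp: less_eq_complex_def\<close>)
qed

end
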